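(* If $x\in W$ is cominuscule, then all elements of $I(x^{-1})$ are integrally indecomposable.
   Context: $G$ is a semisimple algebraic group over an algebraically closed field of characteristic $0$, $B$ a Borel subgroup, $T\subseteq B$ a maximal torus with Lie algebra $\mathfrak{t}$, $W=N_G(T)/T$ the Weyl group, and $\Phi^+$ the positive roots (the weights of $T$ on the unipotent radical of $B$), viewed as elements of $\mathfrak{t}^*$. The inversion set of $x^{-1}$ is $I(x^{-1})=\{\alpha\in\Phi^+ : x^{-1}(\alpha)<0\}$. The element $x\in W$ is cominuscule if there exists $v\in\mathfrak{t}$ such that $\alpha(v)=-1$ for all $\alpha\in I(x^{-1})$. An element of $I(x^{-1})$ is integrally indecomposable if it cannot be expressed as a positive integer linear combination of other elements of $I(x^{-1})$. *)

theory Defs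
  imports
    "HOL-Analysis.Analysis"
    "HOL-Computational_Algebra.Polynomial"
    "HOL-Algebra.Solvable_Groups"
    "HOL-Algebra.Group_Action"
begin

text \<open>
  An algebraic group over an algebraically closed field \<open>'k\<close> is understood in the classical
  (variety) sense. Affine algebraic groups are linear, so they are represented as Zariski closed
  subgroups of a general linear group; matrices have type \<open>'k^'n^'n\<close>, where the size and the
  embedding are arbitrary. Lie algebras are the corresponding tangent spaces at the identity, as
  sets of matrices.
\<close>

definition GL :: "('k::field ^ 'n ^ 'n) monoid" where
  "GL = \<lparr>carrier = {A. invertible A}, mult = (**), one = mat 1\<rparr>"

lemma GL_simps [simp]:
  "carrier GL = {A. invertible A}" "A \<otimes>\<^bsub>GL\<^esub> C = A ** C" "\<one>\<^bsub>GL\<^esub> = mat 1"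
  by (simp_all add: GL_def)

lemma group_GL: "group (GL :: ('k::field ^ 'n ^ 'n) monoid)"
proof (rule groupI)
  fix A :: "'k^'n^'n" assume "A \<in> carrier GL"
  then obtain C where "A ** C = mat 1" "C ** A = mat 1"
    by (auto simp: invertible_def)
  then show "\<exists>C \<in> carrier GL. C \<otimes>\<^bsub>GL\<^esub> A = \<one>\<^bsub>GL\<^esub>"
    by (auto simp: invertible_def)
qed (auto simp: invertible_mult matrix_mul_assoc invertible_def[of "mat 1"])

abbreviation grp :: "('k::field ^ 'n ^ 'n) set \<Rightarrow> ('k ^ 'n ^ 'n) monoid" where
  "grp H \<equiv> GL \<lparr>carrier := H\<rparr>"


subsection \<open>Regular functions and the Zariski topology\<close>

text \<open>
  \<open>regular_diff f D\<close>: the function \<open>f\<close> belongs to the coordinate ring of the general linear group,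
  which is generated by the matrix entries and the inverse of the determinant, and \<open>D\<close> is the
  differential of \<open>f\<close> at the identity matrix, as a linear form on all matrices. The case of
  \<open>inv_det\<close> reflects that the differential of the determinant at the identity is the trace.
  Only the values of \<open>f\<close> at invertible matrices are relevant.
\<close>

inductive regular_diff ::
  "('k::field ^ 'n ^ 'n \<Rightarrow> 'k) \<Rightarrow> ('k ^ 'n ^ 'n \<Rightarrow> 'k) \<Rightarrow> bool" where
  const: "regular_diff (\<lambda>A. c) (\<lambda>X. 0)"
| entry: "regular_diff (\<lambda>A. A $ i $ j) (\<lambda>X. X $ i $ j)"
| inv_det: "regular_diff (\<lambda>A. inverse (det A)) (\<lambda>X. - trace X)"
| add: "\<lbrakk>regular_diff f D; regular_diff g E\<rbrakk>
    \<Longrightarrow> regular_diff (\<lambda>A. f A + g A) (\<lambda>X. D X + E X)"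
| mult: "\<lbrakk>regular_diff f D; regular_diff g E\<rbrakk>
    \<Longrightarrow> regular_diff (\<lambda>A. f A * g A) (\<lambda>X. f (mat 1) * E X + g (mat 1) * D X)"

definition zariski :: "('k::field ^ 'n ^ 'n) topology" where
  "zariski = topology_generated_by
     {{A \<in> carrier GL. f A \<noteq> 0} | f. \<exists>D. regular_diff f D}"

definition closed_subgroup :: "('k::field ^ 'n ^ 'n) set \<Rightarrow> bool" where
  "closed_subgroup G \<longleftrightarrow> subgroup G GL \<and> closedin zariski G"

definition regular_on :: "('k::field ^ 'n ^ 'n) set \<Rightarrow> ('k ^ 'n ^ 'n \<Rightarrow> 'k) \<Rightarrow> bool" where
  "regular_on G h \<longleftrightarrow> (\<exists>f D. regular_diff f D \<and> (\<forall>A\<in>G. h A = f A))"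

definition lie_algebra :: "('k::field ^ 'n ^ 'n) set \<Rightarrow> ('k ^ 'n ^ 'n) set" where
  "lie_algebra G = {X. \<forall>f D. regular_diff f D \<longrightarrow> (\<forall>A\<in>G. f A = 0) \<longrightarrow> D X = 0}"

definition morphism ::
  "('k::field ^ 'n ^ 'n) set \<Rightarrow> ('k ^ 'n ^ 'n) set \<Rightarrow> ('k ^ 'n ^ 'n \<Rightarrow> 'k ^ 'n ^ 'n) \<Rightarrow> bool" where
  "morphism G H \<phi> \<longleftrightarrow> \<phi> \<in> hom (grp G) (grp H) \<and> (\<forall>i j. regular_on G (\<lambda>A. \<phi> A $ i $ j))"

definition isomorphic ::
  "('k::field ^ 'n ^ 'n) set \<Rightarrow> ('k ^ 'n ^ 'n) set \<Rightarrow> bool" where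
  "isomorphic G H \<longleftrightarrow> (\<exists>\<phi> \<psi>. morphism G H \<phi> \<and> morphism H G \<psi> \<and>
     (\<forall>A\<in>G. \<psi> (\<phi> A) = A) \<and> (\<forall>A\<in>H. \<phi> (\<psi> A) = A))"


subsection \<open>Semisimple groups, Borel subgroups, maximal tori\<close>

definition semisimple :: "('k::field ^ 'n ^ 'n) set \<Rightarrow> bool" where
  "semisimple G \<longleftrightarrow> closed_subgroup G \<and> connectedin zariski G \<and>
     (\<forall>R. closed_subgroup R \<and> connectedin zariski R \<and> R \<lhd> grp G \<and> solvable (grp R)
        \<longrightarrow> R = {mat 1})"

definition connected_solvable_subgroup ::
  "('k::field ^ 'n ^ 'n) set \<Rightarrow> ('k ^ 'n ^ 'n) set \<Rightarrow> bool" where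
  "connected_solvable_subgroup G B \<longleftrightarrow>
     closed_subgroup B \<and> B \<subseteq> G \<and> connectedin zariski B \<and> solvable (grp B)"

definition borel_subgroup :: "('k::field ^ 'n ^ 'n) set \<Rightarrow> ('k ^ 'n ^ 'n) set \<Rightarrow> bool" where
  "borel_subgroup G B \<longleftrightarrow> connected_solvable_subgroup G B \<and>
     (\<forall>B'. connected_solvable_subgroup G B' \<and> B \<subseteq> B' \<longrightarrow> B' = B)"

text \<open>
  The standard split torus of rank \<open>card J\<close>. Since a torus in the general linear group of size
  \<open>CARD('n)\<close> has rank at most \<open>CARD('n)\<close>, these are all the models that are needed.
\<close>

definition standard_torus :: "'n set \<Rightarrow> ('k::field ^ 'n ^ 'n) set" where
  "standard_torus J = {A \<in> carrier GL.
     (\<forall>i j. i \<noteq> j \<longrightarrow> A $ i $ j = 0) \<and> (\<forall>i. i \<notin> J \<longrightarrow> A $ i $ i = 1)}"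

definition torus :: "('k::field ^ 'n ^ 'n) set \<Rightarrow> bool" where
  "torus T \<longleftrightarrow> closed_subgroup T \<and> (\<exists>J. isomorphic T (standard_torus J))"

definition maximal_torus :: "('k::field ^ 'n ^ 'n) set \<Rightarrow> ('k ^ 'n ^ 'n) set \<Rightarrow> bool" where
  "maximal_torus G T \<longleftrightarrow> torus T \<and> T \<subseteq> G \<and> (\<forall>T'. torus T' \<and> T' \<subseteq> G \<and> T \<subseteq> T' \<longrightarrow> T' = T)"

definition unipotent :: "('k::field ^ 'n ^ 'n) \<Rightarrow> bool" where
  "unipotent A \<longleftrightarrow> (\<exists>m. (((**) (A - mat 1)) ^^ m) (mat 1) = 0)"

text \<open>
  The closed connected normal unipotent subgroups of \<open>B\<close> have a largest member, which is
  therefore equal to their union.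
\<close>

definition unipotent_radical :: "('k::field ^ 'n ^ 'n) set \<Rightarrow> ('k ^ 'n ^ 'n) set" where
  "unipotent_radical B = \<Union>{U. closed_subgroup U \<and> connectedin zariski U \<and> U \<lhd> grp B \<and>
     (\<forall>u\<in>U. unipotent u)}"


subsection \<open>Roots\<close>

text \<open>
  Elements of the dual space of \<open>lie_algebra T\<close> are represented by functions that are
  \<open>undefined\<close> outside \<open>lie_algebra T\<close>, so that equality of functions is equality in the dual.
\<close>

definition character :: "('k::field ^ 'n ^ 'n) set \<Rightarrow> ('k ^ 'n ^ 'n \<Rightarrow> 'k) \<Rightarrow> bool" where
  "character T \<theta> \<longleftrightarrow> regular_on T \<theta> \<and>
     (\<forall>s\<in>T. \<theta> s \<noteq> 0) \<and> (\<forall>s\<in>T. \<forall>t\<in>T. \<theta> (s ** t) = \<theta> s * \<theta> t)"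

text \<open>The choice of the regular extension of \<open>\<theta>\<close> does not affect the differential on the
  Lie algebra.\<close>

definition has_differential ::
  "('k::field ^ 'n ^ 'n) set \<Rightarrow> ('k ^ 'n ^ 'n \<Rightarrow> 'k) \<Rightarrow> ('k ^ 'n ^ 'n \<Rightarrow> 'k) \<Rightarrow> bool" where
  "has_differential T \<theta> \<alpha> \<longleftrightarrow>
     (\<exists>f D. regular_diff f D \<and> (\<forall>t\<in>T. \<theta> t = f t) \<and> \<alpha> = restrict D (lie_algebra T))"

definition weight_space ::
  "('k::field ^ 'n ^ 'n) set \<Rightarrow> ('k ^ 'n ^ 'n) set \<Rightarrow> ('k ^ 'n ^ 'n \<Rightarrow> 'k) \<Rightarrow> ('k ^ 'n ^ 'n) set" where
  "weight_space T V \<theta> = {X \<in> V. \<forall>t\<in>T. t ** X ** matrix_inv t = mat (\<theta> t) ** X}"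

definition positive_roots ::
  "('k::field ^ 'n ^ 'n) set \<Rightarrow> ('k ^ 'n ^ 'n) set \<Rightarrow> ('k ^ 'n ^ 'n \<Rightarrow> 'k) set" where
  "positive_roots B T = {\<alpha>. \<exists>\<theta>. character T \<theta> \<and> has_differential T \<theta> \<alpha> \<and>
     (\<exists>X \<in> weight_space T (lie_algebra (unipotent_radical B)) \<theta>. X \<noteq> 0)}"


subsection \<open>The Weyl group and inversion sets\<close>

definition weyl_group ::
  "('k::field ^ 'n ^ 'n) set \<Rightarrow> ('k ^ 'n ^ 'n) set \<Rightarrow> ('k ^ 'n ^ 'n) set monoid" where
  "weyl_group G T = grp (normalizer (grp G) T) Mod T"

text \<open>
  The dual of the adjoint action. Elements of the Weyl group are cosets of \<open>T\<close>; as \<open>T\<close> acts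
  trivially on its Lie algebra, the choice of the representative is immaterial.
\<close>

definition weyl_act ::
  "('k::field ^ 'n ^ 'n) set \<Rightarrow> ('k ^ 'n ^ 'n) set \<Rightarrow> ('k ^ 'n ^ 'n \<Rightarrow> 'k) \<Rightarrow> ('k ^ 'n ^ 'n \<Rightarrow> 'k)" where
  "weyl_act T w \<alpha> = (let n = (SOME n. n \<in> w) in
     (\<lambda>H \<in> lie_algebra T. \<alpha> (matrix_inv n ** H ** n)))"

definition negative_root ::
  "('k::field ^ 'n ^ 'n) set \<Rightarrow> ('k ^ 'n ^ 'n) set \<Rightarrow> ('k ^ 'n ^ 'n \<Rightarrow> 'k) \<Rightarrow> bool" where
  "negative_root B T \<beta> \<longleftrightarrow> (\<exists>\<gamma> \<in> positive_roots B T. \<beta> = (\<lambda>H \<in> lie_algebra T. - \<gamma> H))"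

definition inversion_set ::
  "('k::field ^ 'n ^ 'n) set \<Rightarrow> ('k ^ 'n ^ 'n) set \<Rightarrow> ('k ^ 'n ^ 'n) set \<Rightarrow> ('k ^ 'n ^ 'n \<Rightarrow> 'k) set" where
  "inversion_set B T w = {\<alpha> \<in> positive_roots B T. negative_root B T (weyl_act T w \<alpha>)}"

definition cominuscule ::
  "('k::field ^ 'n ^ 'n) set \<Rightarrow> ('k ^ 'n ^ 'n) set \<Rightarrow> ('k ^ 'n ^ 'n) set \<Rightarrow> ('k ^ 'n ^ 'n) set \<Rightarrow> bool" where
  "cominuscule G B T x \<longleftrightarrow> (\<exists>v \<in> lie_algebra T.
     \<forall>\<alpha> \<in> inversion_set B T (inv\<^bsub>weyl_group G T\<^esub> x). \<alpha> v = -1)"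

definition integrally_indecomposable ::
  "('k::field ^ 'n ^ 'n) set \<Rightarrow> ('k ^ 'n ^ 'n \<Rightarrow> 'k) set \<Rightarrow> ('k ^ 'n ^ 'n \<Rightarrow> 'k) \<Rightarrow> bool" where
  "integrally_indecomposable T I \<alpha> \<longleftrightarrow> \<alpha> \<in> I \<and>
     \<not> (\<exists>S (c :: ('k ^ 'n ^ 'n \<Rightarrow> 'k) \<Rightarrow> nat). finite S \<and> S \<subseteq> I - {\<alpha>} \<and> (\<forall>\<beta>\<in>S. c \<beta> > 0) \<and>
          \<alpha> = (\<lambda>H \<in> lie_algebra T. \<Sum>\<beta>\<in>S. of_nat (c \<beta>) * \<beta> H))"

end

theory Submission
  imports Defs
begin

text \<open>
  A witness \<open>v\<close> of cominusculeness takes the same nonzero value \<open>-1\<close> at every element of the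
  inversion set. Evaluating a decomposition of \<open>\<alpha>\<close> with positive integer coefficients at \<open>v\<close>
  therefore compares \<open>-1\<close> with minus the sum of the coefficients. In characteristic \<open>0\<close> this
  forces the coefficients to add up to the natural number \<open>1\<close>, so the decomposition is a single
  summand with coefficient \<open>1\<close>, which is \<open>\<alpha>\<close> itself and not another element.
\<close>

text \<open>
  Roots are thereby determined by their values on the Lie algebra of \<open>T\<close>. A decomposition only
  concerns these values, and one with the single term \<open>\<beta>\<close> and coefficient \<open>1\<close> has to give
  \<open>\<alpha> = \<beta>\<close> as functions.
\<close>

lemma positive_roots_extensional:
  "positive_roots B T \<subseteq> extensional (lie_algebra T)"
  by (auto simp: positive_roots_def has_differential_def)

lemma integrally_indecomposable_if_constant_at:
  fixes I :: "('k::field_char_0 ^ 'n ^ 'n \<Rightarrow> 'k) set"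
  assumes ext: "I \<subseteq> extensional (lie_algebra T)"
    and v: "v \<in> lie_algebra T"
    and const: "\<And>\<beta>. \<beta> \<in> I \<Longrightarrow> \<beta> v = d"
    and "d \<noteq> 0"
    and "\<alpha> \<in> I"
  shows "integrally_indecomposable T I \<alpha>"
proof -
  have False
    if "finite S" and S: "S \<subseteq> I - {\<alpha>}" and pos: "\<forall>\<beta>\<in>S. c \<beta> > 0"
      and \<alpha>: "\<alpha> = (\<lambda>H \<in> lie_algebra T. \<Sum>\<beta>\<in>S. of_nat (c \<beta>) * \<beta> H)"
    for S and c :: "('k ^ 'n ^ 'n \<Rightarrow> 'k) \<Rightarrow> nat"
  proof -
    have "d = (\<Sum>\<beta>\<in>S. of_nat (c \<beta>) * \<beta> v)"
      using const[OF \<open>\<alpha> \<in> I\<close>] \<alpha> v by (metis (no_types, lifting) restrict_apply')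
    also have "\<dots> = (\<Sum>\<beta>\<in>S. of_nat (c \<beta>) * d)"
      using S const by (intro sum.cong) auto
    also have "\<dots> = of_nat (sum c S) * d"
      by (simp add: sum_distrib_right)
    finally have "(of_nat (sum c S) :: 'k) = of_nat 1"
      using \<open>d \<noteq> 0\<close> by simp
    then have "sum c S = 1"
      unfolding of_nat_eq_iff .
    then obtain \<beta> where "\<beta> \<in> S" "c \<beta> = 1" and zero: "\<forall>\<gamma>\<in>S. \<beta> \<noteq> \<gamma> \<longrightarrow> c \<gamma> = 0"
      using sum_eq_1_iff[OF \<open>finite S\<close>, of c] by blast
    have "S = {\<beta>}"
      using zero pos \<open>\<beta> \<in> S\<close> by fastforce
    then have "\<alpha> = restrict \<beta> (lie_algebra T)"
      using \<alpha> \<open>c \<beta> = 1\<close> by simp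
    also have "\<dots> = \<beta>"
      using S ext \<open>\<beta> \<in> S\<close> by (intro extensional_restrict) auto
    finally show False
      using S \<open>\<beta> \<in> S\<close> by blast
  qed
  then show ?thesis
    unfolding integrally_indecomposable_def using \<open>\<alpha> \<in> I\<close> by blast
qed

theorem proposition6p4:
  fixes G B T :: "('k::{alg_closed_field, field_char_0} ^ 'n ^ 'n) set"
    and x :: "('k ^ 'n ^ 'n) set"
  assumes "semisimple G"
    and "borel_subgroup G B"
    and "maximal_torus G T"
    and "T \<subseteq> B"
    and "x \<in> carrier (weyl_group G T)"
    and "cominuscule G B T x"
  shows "\<forall>\<alpha> \<in> inversion_set B T (inv\<^bsub>weyl_group G T\<^esub> x).
           integrally_indecomposable T (inversion_set B T (inv\<^bsub>weyl_group G T\<^esub> x)) \<alpha>"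
proof -
  let ?I = "inversion_set B T (inv\<^bsub>weyl_group G T\<^esub> x)"
  obtain v where v: "v \<in> lie_algebra T" and val: "\<forall>\<beta>\<in>?I. \<beta> v = -1"
    using \<open>cominuscule G B T x\<close> unfolding cominuscule_def by blast
  have "?I \<subseteq> extensional (lie_algebra T)"
    using positive_roots_extensional unfolding inversion_set_def by blast
  moreover have "(-1 :: 'k) \<noteq> 0"
    by simp
  ultimately show ?thesis
    using integrally_indecomposable_if_constant_at[where I = ?I and v = v and d = "-1"] v val
    by blast
qed

end
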